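(* Let $(a_{ij},b_j)$, $1\le i,j\le s$, be the real coefficients of a Runge--Kutta method of order $p$. Consider the method with stages $$y_i = u^n+\Delta t\sum_{j=1}^s a_{ij} f(t_n+c_j\Delta t,y_j),\qquad i=1,\dots,s,$$ and update $$u^{n+1}_\gamma = u^n+\gamma_n\,\Delta t\sum_{j=1}^s b_j f(t_n+c_j\Delta t,y_j),$$ and suppose that the real number $\gamma_n$ (which may depend on $\Delta t$) satisfies $$\gamma_n=1+O(\Delta t^{p-1})\qquad(\Delta t\to0).$$ Then: 1. If $u^{n+1}_\gamma$ is interpreted as an approximation to $u(t_n+\Delta t)$, the method has order $p-1$. 2. If $u^{n+1}_\gamma$ is interpreted as an approximation to $u(t_n+\gamma_n\Delta t)$, the method has order $p$.
   Context: The initial value problem is $u'(t)=f(t,u(t))$, $u(t_0)=u_0$, with $u:\mathbb{R}\to\mathbb{R}^m$, $f:\mathbb{R}\times\mathbb{R}^m\to\mathbb{R}^m$ sufficiently smooth. $\Delta t>0$ is the step size, and $c_i=\sum_j a_{ij}$. For implicit methods and small $\Delta t$, $y_1,\dots,y_s$ is the solution of the stage equations near $u^n$. The unmodified Runge--Kutta method uses the same stages with update $u^{n+1}=u^n+\Delta t\sum_j b_j f(t_n+c_j\Delta t,y_j)$, and has order $p$ if for every problem with sufficiently smooth $f$ and exact starting data $u^n=u(t_n)$ one has $\|u^{n+1}-u(t_n+\Delta t)\|=O(\Delta t^{p+1})$ as $\Delta t\to0$. Likewise, a method whose output $u^{n+1}_\gamma$ is interpreted as an approximation to $u(\tau)$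 (with $\tau=t_n+\Delta t$ or $\tau=t_n+\gamma_n\Delta t$) has order $q$ if, with $u^n=u(t_n)$, $\|u^{n+1}_\gamma-u(\tau)\|=O(\Delta t^{q+1})$. Here "order $q$" means at least $q$. *)

theory Defs
  imports "HOL-Analysis.Analysis" "HOL-Library.Landau_Symbols"
begin

type_synonym 'm vector_field = "real \<Rightarrow> real ^ 'm \<Rightarrow> real ^ 'm"

primrec continuously_differentiable :: "nat \<Rightarrow> ('a::euclidean_space \<Rightarrow> 'b::euclidean_space) \<Rightarrow> bool" where
  "continuously_differentiable 0 f \<longleftrightarrow> continuous_on UNIV f"
| "continuously_differentiable (Suc k) f \<longleftrightarrow>
     (\<forall>x. f differentiable (at x)) \<and>
     (\<forall>v. continuously_differentiable k (\<lambda>x. frechet_derivative f (at x) v))"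

text \<open>``For every sufficiently smooth \<open>f\<close>'' means: for every \<open>f\<close> that is jointly \<open>C\<^sup>k\<close>
  in \<open>(t, x)\<close>, for some \<open>k\<close> that does not depend on \<open>f\<close>.\<close>

definition for_sufficiently_smooth :: "('m::finite vector_field \<Rightarrow> bool) \<Rightarrow> bool" where
  "for_sufficiently_smooth P \<longleftrightarrow>
     (\<exists>k. \<forall>f. continuously_differentiable k (\<lambda>(t, x). f t x) \<longrightarrow> P f)"

definition solves_near :: "'m::finite vector_field \<Rightarrow> real \<Rightarrow> (real \<Rightarrow> real ^ 'm) \<Rightarrow> bool" where
  "solves_near f t0 u \<longleftrightarrow>
     (\<forall>\<^sub>F t in nhds t0. (u has_vector_derivative f t (u t)) (at t))"

definition abscissa :: "real ^ 's ^ 's \<Rightarrow> 's::finite \<Rightarrow> real" where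
  "abscissa a i = (\<Sum>j\<in>UNIV. a $ i $ j)"

definition stage_equations ::
    "real ^ 's ^ 's \<Rightarrow> 'm::finite vector_field \<Rightarrow> real \<Rightarrow> real ^ 'm \<Rightarrow> real \<Rightarrow> ('s::finite \<Rightarrow> real ^ 'm) \<Rightarrow> bool" where
  "stage_equations a f tn un h y \<longleftrightarrow>
     (\<forall>i. y i = un + h *\<^sub>R (\<Sum>j\<in>UNIV. a $ i $ j *\<^sub>R f (tn + abscissa a j * h) (y j)))"

text \<open>The stage equations may have several solutions. The one near \<open>un\<close> is selected by requiring
  convergence to \<open>un\<close> as the step size tends to \<open>0\<close>: by the contraction principle, for \<open>C\<^sup>1\<close>
  vector fields such a family exists, and any two agree for all small step sizes.\<close>

definition stages_near ::
    "real ^ 's ^ 's \<Rightarrow> 'm::finite vector_field \<Rightarrow> real \<Rightarrow> real ^ 'm \<Rightarrow> (real \<Rightarrow> 's::finite \<Rightarrow> real ^ 'm) \<Rightarrow> bool" where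
  "stages_near a f tn un y \<longleftrightarrow>
     (\<forall>\<^sub>F h in at_right 0. stage_equations a f tn un h (y h)) \<and>
     (\<forall>i. ((\<lambda>h. y h i) \<longlongrightarrow> un) (at_right 0))"

text \<open>An update rule maps vector field, current time, current value, step size and stage values to
  the next value. A step parameter is a number that may depend on the problem and on the step size.\<close>

type_synonym ('s, 'm) update =
  "'m vector_field \<Rightarrow> real \<Rightarrow> real ^ 'm \<Rightarrow> real \<Rightarrow> ('s \<Rightarrow> real ^ 'm) \<Rightarrow> real ^ 'm"

type_synonym 'm step_parameter =
  "'m vector_field \<Rightarrow> real \<Rightarrow> real ^ 'm \<Rightarrow> real \<Rightarrow> real"

definition rk_update :: "real ^ 's ^ 's \<Rightarrow> real ^ 's \<Rightarrow> ('s::finite, 'm::finite) update" where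
  "rk_update a b f tn un h y =
     un + h *\<^sub>R (\<Sum>j\<in>UNIV. b $ j *\<^sub>R f (tn + abscissa a j * h) (y j))"

definition relaxed_update ::
    "real ^ 's ^ 's \<Rightarrow> real ^ 's \<Rightarrow> 'm step_parameter \<Rightarrow> ('s::finite, 'm::finite) update" where
  "relaxed_update a b \<gamma> f tn un h y =
     un + (\<gamma> f tn un h * h) *\<^sub>R (\<Sum>j\<in>UNIV. b $ j *\<^sub>R f (tn + abscissa a j * h) (y j))"

text \<open>Order at least \<open>q\<close> of the method with stage coefficients \<open>a\<close> and update rule \<open>\<Phi>\<close>, its output
  being interpreted as an approximation to the exact solution at time \<open>\<tau> f tn (u tn) h\<close>.\<close>

definition has_order ::
    "real ^ 's ^ 's \<Rightarrow> ('s::finite, 'm::finite) update \<Rightarrow> 'm step_parameter \<Rightarrow> nat \<Rightarrow> bool" where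
  "has_order a \<Phi> \<tau> q \<longleftrightarrow>
     for_sufficiently_smooth (\<lambda>f. \<forall>tn u y.
       solves_near f tn u \<longrightarrow> stages_near a f tn (u tn) y \<longrightarrow>
       (\<lambda>h. norm (\<Phi> f tn (u tn) h (y h) - u (\<tau> f tn (u tn) h))) \<in> O[at_right 0](\<lambda>h. h ^ (q + 1)))"

end

theory Submission imports Defs begin

text \<open>Write \<open>F\<close> for the weighted sum of stage values of \<open>f\<close>, so that the unmodified step is
  \<open>u(t\<^sub>n) + h F\<close>, and let \<open>e = u(t\<^sub>n) + h F - u(t\<^sub>n + h) = O(h ^ (p + 1))\<close> be its error. The two
  errors of the relaxed step are
  \<open>e + (\<gamma> - 1) h F\<close> with respect to \<open>u(t\<^sub>n + h)\<close>, and
  \<open>e + (\<gamma> - 1) h F - (u(t\<^sub>n + \<gamma> h) - u(t\<^sub>n + h))\<close> with respect to \<open>u(t\<^sub>n + \<gamma> h)\<close>.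
  Since \<open>p \<ge> 1\<close>, the method is consistent: \<open>F = u'(t\<^sub>n) + O(h)\<close>. In the first error, \<open>F\<close> is thus
  bounded and \<open>(\<gamma> - 1) h F = O(h ^ p)\<close>. In the second, \<open>u(t\<^sub>n + \<gamma> h) - u(t\<^sub>n + h)\<close> agrees with
  \<open>(\<gamma> - 1) h u'(t\<^sub>n)\<close> up to \<open>O((\<gamma> - 1) h \<cdot> h)\<close>, because \<open>u'\<close> varies by \<open>O(h)\<close> over the times
  involved. The leading terms cancel and only \<open>(\<gamma> - 1) h \<cdot> O(h) = O(h ^ (p + 1))\<close> is left.

  Consistency is read off from the order of the unmodified method, not from the coefficients:
  \<open>h F = e + (u(t\<^sub>n + h) - u(t\<^sub>n)) = h u'(t\<^sub>n) + O(h\<^sup>2)\<close>. Besides the smoothness demanded by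
  the hypotheses on the order and on \<open>\<gamma>\<close>, the argument uses that \<open>f\<close> is differentiable, so that
  \<open>u' = f(t, u)\<close> is differentiable at \<open>t\<^sub>n\<close> (\<open>solution_slope_differentiable\<close>). This gives the
  bound on increments of \<open>u\<close> (\<open>increment_linearization_bound\<close>), from which the estimates for both
  errors follow (\<open>relaxed_step_error\<close>).\<close>

lemma continuously_differentiable_Suc_imp:
  "continuously_differentiable (Suc k) f \<Longrightarrow> continuously_differentiable k f"
proof (induction k arbitrary: f)
  case 0
  then show ?case
    by (auto simp: continuous_on_eq_continuous_at intro!: differentiable_imp_continuous_within)
next
  case (Suc k)
  then show ?case
    by (metis continuously_differentiable.simps(2))
qed

lemma continuously_differentiable_antimono:
  assumes "k \<le> l" and "continuously_differentiable l f"
  shows "continuously_differentiable k f"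
  using assms by (induction rule: dec_induct) (blast dest: continuously_differentiable_Suc_imp)+

text \<open>Two conditions may require different classes \<open>C\<^sup>k\<close> and \<open>C\<^sup>l\<close>; both hold on the smaller one.\<close>

lemma for_sufficiently_smooth_conj:
  assumes "for_sufficiently_smooth P" and "for_sufficiently_smooth Q"
  shows "for_sufficiently_smooth (\<lambda>f. P f \<and> Q f)"
proof -
  obtain k l where
    "\<forall>f. continuously_differentiable k (\<lambda>(t, x). f t x) \<longrightarrow> P f"
    "\<forall>f. continuously_differentiable l (\<lambda>(t, x). f t x) \<longrightarrow> Q f"
    using assms unfolding for_sufficiently_smooth_def by blast
  then have "\<forall>f. continuously_differentiable (max k l) (\<lambda>(t, x). f t x) \<longrightarrow> P f \<and> Q f"
    by (meson continuously_differentiable_antimono max.cobounded1 max.cobounded2)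
  then show ?thesis
    unfolding for_sufficiently_smooth_def by blast
qed

lemma for_sufficiently_smooth_mono:
  assumes "for_sufficiently_smooth P" and "\<And>f. P f \<Longrightarrow> Q f"
  shows "for_sufficiently_smooth Q"
  using assms unfolding for_sufficiently_smooth_def by blast

lemma for_sufficiently_smooth_differentiable:
  "for_sufficiently_smooth (\<lambda>f. \<forall>z. (\<lambda>(t, x). f t x) differentiable (at z))"
  unfolding for_sufficiently_smooth_def by (intro exI[of _ "Suc 0"]) simp

lemma differentiable_imp_locally_Lipschitz_at:
  fixes g :: "'a::real_normed_vector \<Rightarrow> 'b::real_normed_vector"
  assumes "g differentiable (at x)"
  obtains L where "L \<ge> 0" and "\<forall>\<^sub>F y in nhds x. norm (g y - g x) \<le> L * norm (y - x)"
proof -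
  obtain D where "(g has_derivative D) (at x)"
    using assms unfolding differentiable_def by blast
  then have lin: "bounded_linear D"
    and approx: "\<forall>e>0. \<exists>d>0. \<forall>y. norm (y - x) < d \<longrightarrow>
      norm (g y - g x - D (y - x)) \<le> e * norm (y - x)"
    unfolding has_derivative_at_alt by auto
  obtain K where "K > 0" and K: "\<And>v. norm (D v) \<le> norm v * K"
    using bounded_linear.pos_bounded[OF lin] by blast
  obtain d where "d > 0"
    and d: "\<And>y. norm (y - x) < d \<Longrightarrow> norm (g y - g x - D (y - x)) \<le> 1 * norm (y - x)"
    using approx[rule_format, of 1] by auto
  have "norm (g y - g x) \<le> (K + 1) * norm (y - x)" if "dist y x < d" for y
  proof -
    have "norm (g y - g x) \<le> norm (g y - g x - D (y - x)) + norm (D (y - x))"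
      by (metis diff_add_cancel norm_triangle_ineq)
    also have "\<dots> \<le> 1 * norm (y - x) + norm (y - x) * K"
      using d[of y] K[of "y - x"] that by (intro add_mono) (auto simp: dist_norm)
    finally show ?thesis
      by (simp add: algebra_simps)
  qed
  then have "\<forall>\<^sub>F y in nhds x. norm (g y - g x) \<le> (K + 1) * norm (y - x)"
    using \<open>d > 0\<close> unfolding eventually_nhds_metric by blast
  with \<open>K > 0\<close> show ?thesis
    by (intro that[of "K + 1"]) auto
qed

text \<open>Over the times within \<open>r\<close> of \<open>t\<^sub>0\<close> the slope differs from \<open>v t\<^sub>0\<close> by \<open>O(r)\<close>, so the mean
  value inequality applies. Comparing two points near \<open>t\<^sub>0\<close>, rather than one point with \<open>t\<^sub>0\<close>,
  keeps the factor \<open>\<bar>x - y\<bar>\<close>: for \<open>x = t\<^sub>0 + \<gamma> h\<close> and \<open>y = t\<^sub>0 + h\<close> it is \<open>\<bar>\<gamma> - 1\<bar> h\<close>, which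
  for \<open>p > 1\<close> is of smaller order than \<open>r = O(h)\<close>.\<close>

lemma increment_linearization_bound:
  fixes u v :: "real \<Rightarrow> 'a::real_normed_vector"
  assumes deriv: "\<forall>\<^sub>F t in nhds t0. (u has_vector_derivative v t) (at t)"
    and diff: "v differentiable (at t0)"
  obtains L \<delta> where "L \<ge> 0" and "\<delta> > 0"
    and "\<And>x y r. r < \<delta> \<Longrightarrow> \<bar>x - t0\<bar> \<le> r \<Longrightarrow> \<bar>y - t0\<bar> \<le> r \<Longrightarrow>
           norm (u x - u y - (x - y) *\<^sub>R v t0) \<le> L * r * \<bar>x - y\<bar>"
proof -
  obtain L where "L \<ge> 0" and L: "\<forall>\<^sub>F t in nhds t0. norm (v t - v t0) \<le> L * norm (t - t0)"
    using differentiable_imp_locally_Lipschitz_at[OF diff] .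
  obtain \<delta> where "\<delta> > 0" and \<delta>: "\<And>t. dist t t0 < \<delta> \<Longrightarrow>
      (u has_vector_derivative v t) (at t) \<and> norm (v t - v t0) \<le> L * norm (t - t0)"
    using eventually_conj[OF deriv L] unfolding eventually_nhds_metric by blast
  have "norm (u x - u y - (x - y) *\<^sub>R v t0) \<le> L * r * \<bar>x - y\<bar>"
    if "r < \<delta>" "\<bar>x - t0\<bar> \<le> r" "\<bar>y - t0\<bar> \<le> r" for x y r
  proof -
    have near: "dist t t0 < \<delta>" if "t \<in> cball t0 r" for t
      using that \<open>r < \<delta>\<close> by (simp add: dist_commute)
    have "norm (u x - u y - (x - y) *\<^sub>R v t0) \<le> norm (x - y) * (L * r)"
    proof (rule vector_differentiable_bound_linearization)
      show "(u has_vector_derivative v t) (at t within cball t0 r)" if "t \<in> cball t0 r" for t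
        using \<delta>[OF near[OF that]] has_vector_derivative_at_within by blast
      show "norm (v t - v t0) \<le> L * r" if "t \<in> cball t0 r" for t
      proof -
        have "norm (v t - v t0) \<le> L * norm (t - t0)"
          using \<delta>[OF near[OF that]] by blast
        also have "\<dots> \<le> L * r"
          using that \<open>L \<ge> 0\<close> by (intro mult_left_mono) (auto simp: dist_norm abs_minus_commute)
        finally show ?thesis .
      qed
      show "closed_segment y x \<subseteq> cball t0 r"
        using \<open>\<bar>x - t0\<bar> \<le> r\<close> \<open>\<bar>y - t0\<bar> \<le> r\<close>
        by (intro closed_segment_subset) (auto simp: dist_norm abs_minus_commute)
      show "t0 \<in> cball t0 r"
        using \<open>\<bar>x - t0\<bar> \<le> r\<close> by auto
    qed
    then show ?thesis
      by (simp add: mult.commute)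
  qed
  with \<open>L \<ge> 0\<close> \<open>\<delta> > 0\<close> show ?thesis
    using that by blast
qed

lemma bigo_at_right_0_powerD:
  fixes g :: "real \<Rightarrow> real"
  assumes "g \<in> O[at_right 0](\<lambda>h. h ^ k)"
  obtains C where "C \<ge> 0" and "\<forall>\<^sub>F h in at_right 0. \<bar>g h\<bar> \<le> C * h ^ k"
proof -
  obtain C where "C > 0" and C: "\<forall>\<^sub>F h in at_right 0. norm (g h) \<le> C * norm (h ^ k)"
    using assms by (rule landau_o.bigE)
  have "\<forall>\<^sub>F h in at_right 0. \<bar>g h\<bar> \<le> C * h ^ k"
    using C eventually_at_right_less[of 0] by eventually_elim simp
  with \<open>C > 0\<close> show ?thesis
    by (intro that[of C]) auto
qed

lemma norm_bigo_at_right_0_powerI: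
  fixes g :: "real \<Rightarrow> 'a::real_normed_vector"
  assumes "\<forall>\<^sub>F h in at_right 0. norm (g h) \<le> C * h ^ k"
  shows "(\<lambda>h. norm (g h)) \<in> O[at_right 0](\<lambda>h. h ^ k)"
proof (rule landau_o.bigI)
  show "\<forall>\<^sub>F h in at_right 0. norm (norm (g h)) \<le> max C 1 * norm (h ^ k)"
    using assms eventually_at_right_less[of 0]
  proof eventually_elim
    case (elim h)
    have "C * h ^ k \<le> max C 1 * h ^ k"
      using elim(2) by (intro mult_right_mono) auto
    with elim(1) have "norm (g h) \<le> max C 1 * h ^ k"
      by linarith
    then show ?case
      using elim(2) by simp
  qed
qed simp

text \<open>Along a single trajectory the method is visible only through the increment \<open>F\<close>. That
  \<open>F h\<close> is within \<open>O(h)\<close> of the initial slope follows from the error bound for the step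
  \<open>u t\<^sub>0 + h F h\<close>, because \<open>p \<ge> 1\<close> makes this error \<open>O(h\<^sup>2)\<close>. The error at time \<open>t\<^sub>0 + h\<close>
  loses one power of \<open>h\<close> because there the term \<open>(\<gamma> h - 1) h F h\<close> is not compensated by a
  displacement of the exact solution.\<close>

lemma relaxed_step_error:
  fixes u v F :: "real \<Rightarrow> 'a::real_normed_vector" and \<gamma> :: "real \<Rightarrow> real"
  assumes "1 \<le> p"
    and deriv: "\<forall>\<^sub>F t in nhds t0. (u has_vector_derivative v t) (at t)"
    and diff: "v differentiable (at t0)"
    and step: "(\<lambda>h. norm (u t0 + h *\<^sub>R F h - u (t0 + h))) \<in> O[at_right 0](\<lambda>h. h ^ (p + 1))"
    and \<gamma>: "(\<lambda>h. \<gamma> h - 1) \<in> O[at_right 0](\<lambda>h. h ^ (p - 1))"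
  shows "(\<lambda>h. norm (u t0 + (\<gamma> h * h) *\<^sub>R F h - u (t0 + h))) \<in> O[at_right 0](\<lambda>h. h ^ p)"
    and "(\<lambda>h. norm (u t0 + (\<gamma> h * h) *\<^sub>R F h - u (t0 + \<gamma> h * h))) \<in> O[at_right 0](\<lambda>h. h ^ (p + 1))"
proof -
  define e where "e h = u t0 + h *\<^sub>R F h - u (t0 + h)" for h
  obtain L \<delta> where "L \<ge> 0" "\<delta> > 0"
    and lin: "\<And>x y r. r < \<delta> \<Longrightarrow> \<bar>x - t0\<bar> \<le> r \<Longrightarrow> \<bar>y - t0\<bar> \<le> r \<Longrightarrow>
      norm (u x - u y - (x - y) *\<^sub>R v t0) \<le> L * r * \<bar>x - y\<bar>"
    using increment_linearization_bound[OF deriv diff] by blast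
  obtain C where "C \<ge> 0" and C: "\<forall>\<^sub>F h in at_right 0. norm (e h) \<le> C * h ^ (p + 1)"
    using bigo_at_right_0_powerD[OF step] by (auto simp: e_def)
  obtain D where "D \<ge> 0" and D: "\<forall>\<^sub>F h in at_right 0. \<bar>\<gamma> h - 1\<bar> \<le> D * h ^ (p - 1)"
    using bigo_at_right_0_powerD[OF \<gamma>] .
  \<comment> \<open>As \<open>\<bar>\<gamma> h\<bar> \<le> 1 + D\<close> for \<open>h < 1\<close>, both \<open>t0 + h\<close> and \<open>t0 + \<gamma> h * h\<close> have distance at most
    \<open>(1 + D) * h\<close> from \<open>t0\<close>, and this has to be below \<open>\<delta>\<close>.\<close>
  have small: "\<forall>\<^sub>F h in at_right 0. 0 < h \<and> h < 1 \<and> h < \<delta> / (1 + D)"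
    using \<open>\<delta> > 0\<close> \<open>D \<ge> 0\<close>
    by (intro eventually_conj eventually_at_right_less order_tendstoD(2)[OF tendsto_ident_at]) auto
  have bounds: "\<forall>\<^sub>F h in at_right 0.
      norm (u t0 + (\<gamma> h * h) *\<^sub>R F h - u (t0 + h)) \<le> (C + D * (C + L + norm (v t0))) * h ^ p \<and>
      norm (u t0 + (\<gamma> h * h) *\<^sub>R F h - u (t0 + \<gamma> h * h))
        \<le> (C + D * (C + L) + L * (1 + D) * D) * h ^ (p + 1)"
    using small C D
  proof eventually_elim
    case (elim h)
    then have h: "0 < h" "h < 1" and h\<delta>: "(1 + D) * h < \<delta>"
      using \<open>D \<ge> 0\<close> by (auto simp: field_simps)
    have "h ^ (p - 1) \<le> 1"
      using h by (intro power_le_one) auto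
    then have "\<bar>\<gamma> h - 1\<bar> \<le> D"
      using elim \<open>D \<ge> 0\<close> by (meson mult_left_le order_trans)
    then have "\<bar>\<gamma> h\<bar> \<le> 1 + D"
      by linarith
    have pow: "h ^ (p - 1) * h = h ^ p" "h ^ p * h = h ^ (p + 1)"
      using \<open>1 \<le> p\<close> by (auto simp: power_eq_if)
    have \<gamma>h: "\<bar>\<gamma> h - 1\<bar> * h \<le> D * h ^ p"
      using elim(3) h by (metis mult.assoc mult_right_mono less_imp_le pow(1))
    have ph: "h ^ (p + 1) \<le> h * h" "h ^ (p + 1) \<le> h ^ p"
      using h \<open>1 \<le> p\<close> power_decreasing[of 2 "p + 1" h] power_decreasing[of p "p + 1" h]
      by (auto simp: power2_eq_square)
    have e: "norm (e h) \<le> C * (h * h)" "norm (e h) \<le> C * h ^ p"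
      using elim(2) ph[THEN mult_left_mono, OF \<open>C \<ge> 0\<close>] by linarith+
    have consistent: "norm (F h - v t0) \<le> (C + L) * h"
    proof -
      have "h \<le> (1 + D) * h"
        using h \<open>D \<ge> 0\<close> by simp
      then have "h < \<delta>"
        using h\<delta> by simp
      have "h * norm (F h - v t0) = norm (e h + (u (t0 + h) - u t0 - h *\<^sub>R v t0))"
        using h by (simp add: e_def flip: scaleR_diff_right)
      also have "\<dots> \<le> norm (e h) + norm (u (t0 + h) - u t0 - h *\<^sub>R v t0)"
        by (rule norm_triangle_ineq)
      also have "\<dots> \<le> C * (h * h) + L * h * h"
        using lin[of h "t0 + h" t0] h \<open>h < \<delta>\<close> e(1) by (intro add_mono) auto
      finally have "h * norm (F h - v t0) \<le> h * ((C + L) * h)"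
        by (simp add: algebra_simps)
      then show ?thesis
        using h by simp
    qed
    have "norm (F h) \<le> norm (F h - v t0) + norm (v t0)"
      by (metis diff_add_cancel norm_triangle_ineq)
    also have "\<dots> \<le> (C + L) * 1 + norm (v t0)"
      using h \<open>C \<ge> 0\<close> \<open>L \<ge> 0\<close>
      by (intro add_right_mono order_trans[OF consistent] mult_left_mono) auto
    finally have F: "norm (F h) \<le> C + L + norm (v t0)"
      by simp
    have "norm (u t0 + (\<gamma> h * h) *\<^sub>R F h - u (t0 + h)) = norm (e h + ((\<gamma> h - 1) * h) *\<^sub>R F h)"
      by (simp add: e_def algebra_simps)
    also have "\<dots> \<le> norm (e h) + (\<bar>\<gamma> h - 1\<bar> * h) * norm (F h)"
      using h norm_triangle_ineq[of "e h" "((\<gamma> h - 1) * h) *\<^sub>R F h"] by (simp add: abs_mult)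
    also have "\<dots> \<le> C * h ^ p + (D * h ^ p) * (C + L + norm (v t0))"
      using e(2) h \<open>D \<ge> 0\<close> by (intro add_mono mult_mono[OF \<gamma>h F]) auto
    finally have 1: "norm (u t0 + (\<gamma> h * h) *\<^sub>R F h - u (t0 + h))
        \<le> (C + D * (C + L + norm (v t0))) * h ^ p"
      by (simp add: algebra_simps)
    have \<gamma>h_eq: "\<gamma> h * h - h = (\<gamma> h - 1) * h"
      by (simp add: left_diff_distrib)
    have increment: "norm (u (t0 + \<gamma> h * h) - u (t0 + h) - ((\<gamma> h - 1) * h) *\<^sub>R v t0)
        \<le> L * ((1 + D) * h) * (\<bar>\<gamma> h - 1\<bar> * h)"
      using lin[of "(1 + D) * h" "t0 + \<gamma> h * h" "t0 + h"] h h\<delta> \<open>\<bar>\<gamma> h\<bar> \<le> 1 + D\<close> \<open>D \<ge> 0\<close>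
      by (simp add: abs_mult \<gamma>h_eq)
    \<comment> \<open>The displacements of the numerical and of the exact solution share the linear term
      \<open>((\<gamma> h - 1) * h) *\<^sub>R v t0\<close>; its cancellation saves one power of \<open>h\<close>.\<close>
    have "u t0 + (\<gamma> h * h) *\<^sub>R F h - u (t0 + \<gamma> h * h) =
        e h + ((\<gamma> h - 1) * h) *\<^sub>R (F h - v t0)
          - (u (t0 + \<gamma> h * h) - u (t0 + h) - ((\<gamma> h - 1) * h) *\<^sub>R v t0)"
      by (simp add: e_def algebra_simps)
    then have "norm (u t0 + (\<gamma> h * h) *\<^sub>R F h - u (t0 + \<gamma> h * h)) \<le>
        norm (e h) + norm (((\<gamma> h - 1) * h) *\<^sub>R (F h - v t0))
          + norm (u (t0 + \<gamma> h * h) - u (t0 + h) - ((\<gamma> h - 1) * h) *\<^sub>R v t0)"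
      by (smt (verit) norm_triangle_ineq norm_triangle_ineq4)
    also have "norm (((\<gamma> h - 1) * h) *\<^sub>R (F h - v t0)) = (\<bar>\<gamma> h - 1\<bar> * h) * norm (F h - v t0)"
      using h by (simp add: abs_mult)
    also have "norm (e h) + (\<bar>\<gamma> h - 1\<bar> * h) * norm (F h - v t0)
          + norm (u (t0 + \<gamma> h * h) - u (t0 + h) - ((\<gamma> h - 1) * h) *\<^sub>R v t0)
        \<le> C * h ^ (p + 1) + (D * h ^ p) * ((C + L) * h) + L * ((1 + D) * h) * (D * h ^ p)"
      using elim(2) h \<open>D \<ge> 0\<close> \<open>L \<ge> 0\<close>
      by (intro add_mono mult_mono[OF \<gamma>h consistent]
          order_trans[OF increment] mult_left_mono[OF \<gamma>h]) auto
    also have "\<dots> = (C + D * (C + L) + L * (1 + D) * D) * h ^ (p + 1)"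
      by (simp add: algebra_simps)
    finally show ?case
      using 1 by blast
  qed
  show "(\<lambda>h. norm (u t0 + (\<gamma> h * h) *\<^sub>R F h - u (t0 + h))) \<in> O[at_right 0](\<lambda>h. h ^ p)"
    by (rule norm_bigo_at_right_0_powerI, rule eventually_mono[OF bounds], elim conjE)
  show "(\<lambda>h. norm (u t0 + (\<gamma> h * h) *\<^sub>R F h - u (t0 + \<gamma> h * h))) \<in> O[at_right 0](\<lambda>h. h ^ (p + 1))"
    by (rule norm_bigo_at_right_0_powerI, rule eventually_mono[OF bounds], elim conjE)
qed

lemma solution_slope_differentiable:
  assumes "\<forall>z. (\<lambda>(t, x). f t x) differentiable (at z)" and "solves_near f t0 u"
  shows "(\<lambda>t. f t (u t)) differentiable (at t0)"
proof -
  have "(u has_vector_derivative f t0 (u t0)) (at t0)"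
    using assms(2) unfolding solves_near_def by (rule eventually_nhds_x_imp_x)
  then have "(\<lambda>t. (t, u t)) differentiable (at t0)"
    unfolding has_vector_derivative_def
    by (rule differentiableI[OF has_derivative_Pair[OF has_derivative_ident]])
  then have "((\<lambda>(t, x). f t x) \<circ> (\<lambda>t. (t, u t))) differentiable (at t0)"
    using assms(1) by (intro differentiable_chain_at) blast+
  then show ?thesis
    by (simp add: o_def)
qed

theorem theorem3:
  fixes a :: "real ^ 's ^ 's" and b :: "real ^ 's" and p :: nat
    and \<gamma> :: "'m::finite step_parameter"
  assumes "1 \<le> p"
    and "has_order a (rk_update a b :: ('s::finite, 'm) update) (\<lambda>f tn un h. tn + h) p"
    and "for_sufficiently_smooth (\<lambda>f. \<forall>tn un.
           (\<lambda>h. \<gamma> f tn un h - 1) \<in> O[at_right 0](\<lambda>h. h ^ (p - 1)))"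
  shows "has_order a (relaxed_update a b \<gamma>) (\<lambda>f tn un h. tn + h) (p - 1) \<and>
         has_order a (relaxed_update a b \<gamma>) (\<lambda>f tn un h. tn + \<gamma> f tn un h * h) p"
proof -
  note hyps = for_sufficiently_smooth_conj[OF for_sufficiently_smooth_differentiable
      for_sufficiently_smooth_conj[OF assms(2)[unfolded has_order_def] assms(3)]]
  have both: "(\<lambda>h. norm (relaxed_update a b \<gamma> f tn (u tn) h (y h) - u (tn + h)))
        \<in> O[at_right 0](\<lambda>h. h ^ (p - 1 + 1)) \<and>
      (\<lambda>h. norm (relaxed_update a b \<gamma> f tn (u tn) h (y h) - u (tn + \<gamma> f tn (u tn) h * h)))
        \<in> O[at_right 0](\<lambda>h. h ^ (p + 1))"
    if diff: "\<forall>z. (\<lambda>(t, x). f t x) differentiable (at z)"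
      and order: "\<forall>tn u y. solves_near f tn u \<longrightarrow> stages_near a f tn (u tn) y \<longrightarrow>
        (\<lambda>h. norm (rk_update a b f tn (u tn) h (y h) - u (tn + h)))
          \<in> O[at_right 0](\<lambda>h. h ^ (p + 1))"
      and \<gamma>: "\<forall>tn un. (\<lambda>h. \<gamma> f tn un h - 1) \<in> O[at_right 0](\<lambda>h. h ^ (p - 1))"
      and u: "solves_near f tn u" and y: "stages_near a f tn (u tn) y"
    for f tn u and y :: "real \<Rightarrow> 's \<Rightarrow> real ^ 'm"
  proof -
    define F where "F h = (\<Sum>j\<in>UNIV. b $ j *\<^sub>R f (tn + abscissa a j * h) (y h j))" for h
    have "(\<lambda>h. norm (u tn + h *\<^sub>R F h - u (tn + h))) \<in> O[at_right 0](\<lambda>h. h ^ (p + 1))"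
      using order u y by (simp add: rk_update_def F_def)
    note error = relaxed_step_error[OF \<open>1 \<le> p\<close> u[unfolded solves_near_def]
        solution_slope_differentiable[OF diff u] this \<gamma>[rule_format, of tn "u tn"]]
    show ?thesis
      using error \<open>1 \<le> p\<close> by (simp add: relaxed_update_def F_def)
  qed
  show ?thesis
    unfolding has_order_def
    by (intro conjI; rule for_sufficiently_smooth_mono[OF hyps]) (use both in blast)+
qed

end
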